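(* For any positive integers $m$ and $n$ such that $m \leq 3$, the metagraph $\mathcal{M}(G(m, n), 3)$ is connected.
   Context: $G(m,n)$ denotes the $m \times n$ grid graph: its vertices are the cells of an $m \times n$ rectangular array, and two cells are adjacent exactly when they are horizontal or vertical neighbors. For a graph $G$ and a positive integer $t$, the metagraph $\mathcal{M}(G,t)$ is the graph whose vertices are the (unordered) partitions of the vertex set of $G$ into parts, each containing exactly $t$ vertices and inducing a connected subgraph of $G$; two distinct partitions are joined by an edge whenever they differ only on two parts (i.e., one is obtained from the other by replacing two parts by two other parts with the same union, all other parts being unchanged). A metagraph with at most one vertex (including the case of no vertices, e.g. when $t$ does not divide the number of vertices of $G$) is considered connected. *)

theory Defs
  imports "Graph_Theory.Graph_Theory" "HOL-Library.Disjoint_Sets"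
begin

text \<open>A simple graph is represented by the symmetric loop-free pair digraph that has both
  orientations of every edge as arcs (locale \<^locale>\<open>pair_graph\<close>).\<close>

definition grid_graph :: "nat \<Rightarrow> nat \<Rightarrow> (nat \<times> nat) pair_pre_digraph" where
  "grid_graph m n = \<lparr>
     pverts = {..<m} \<times> {..<n},
     parcs = {((i, j), (i', j')).
       (i, j) \<in> {..<m} \<times> {..<n} \<and> (i', j') \<in> {..<m} \<times> {..<n} \<and>
       (i = i' \<and> (j' = Suc j \<or> j = Suc j') \<or> j = j' \<and> (i' = Suc i \<or> i = Suc i'))} \<rparr>"

definition connected_partitions :: "'a pair_pre_digraph \<Rightarrow> nat \<Rightarrow> 'a set set set" where
  "connected_partitions G t = {P. partition_on (pverts G) P \<and>
     (\<forall>A\<in>P. card A = t \<and> Digraph_Component.connected (with_proj G \<restriction> A))}"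

definition differ_on_two_parts :: "'a set set \<Rightarrow> 'a set set \<Rightarrow> bool" where
  "differ_on_two_parts P Q \<longleftrightarrow> P \<noteq> Q \<and>
     (\<exists>A\<in>P. \<exists>B\<in>P. \<exists>C\<in>Q. \<exists>D\<in>Q. A \<noteq> B \<and> C \<noteq> D \<and> A \<union> B = C \<union> D \<and> P - {A, B} = Q - {C, D})"

definition metagraph :: "'a pair_pre_digraph \<Rightarrow> nat \<Rightarrow> 'a set set pair_pre_digraph" where
  "metagraph G t = \<lparr>
     pverts = connected_partitions G t,
     parcs = {(P, Q). P \<in> connected_partitions G t \<and> Q \<in> connected_partitions G t \<and>
       differ_on_two_parts P Q} \<rparr>"

text \<open>The library's \<^const>\<open>Digraph_Component.connected\<close> excludes the graph without vertices,
  whereas a metagraph without vertices counts as connected.\<close>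

definition connected_or_empty :: "'a pair_pre_digraph \<Rightarrow> bool" where
  "connected_or_empty G \<longleftrightarrow> pverts G = {} \<or> Digraph_Component.connected (with_proj G)"

lemma pair_graph_grid_graph: "pair_graph (grid_graph m n)"
proof -
  have "parcs (grid_graph m n) \<subseteq> pverts (grid_graph m n) \<times> pverts (grid_graph m n)"
    by (auto simp: grid_graph_def)
  moreover have "finite (pverts (grid_graph m n))"
    by (simp add: grid_graph_def)
  ultimately have "finite (parcs (grid_graph m n))"
    using finite_subset by blast
  then show ?thesis
    by unfold_locales (auto simp: grid_graph_def symmetric_def intro!: symI)
qed

lemma differ_on_two_parts_sym: "differ_on_two_parts P Q \<Longrightarrow> differ_on_two_parts Q P"
  unfolding differ_on_two_parts_def by metis

lemma pair_graph_metagraph: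
  assumes "finite (pverts G)"
  shows "pair_graph (metagraph G t)"
proof -
  have "connected_partitions G t \<subseteq> Pow (Pow (pverts G))"
    by (auto simp: connected_partitions_def partition_on_def)
  with assms have fin: "finite (pverts (metagraph G t))"
    by (simp add: metagraph_def finite_subset)
  moreover have "parcs (metagraph G t) \<subseteq> pverts (metagraph G t) \<times> pverts (metagraph G t)"
    by (auto simp: metagraph_def)
  ultimately have "finite (parcs (metagraph G t))"
    using finite_subset by blast
  with fin show ?thesis
    by unfold_locales
      (auto simp: metagraph_def symmetric_def differ_on_two_parts_def[of P P for P]
        intro!: symI differ_on_two_parts_sym)
qed

end

theory Submission
  imports Defs
begin

text \<open>
  Two tilings by trominoes are joined by flips if both can be flipped into tilings that contain one
  common tile \<open>s\<close> and if the tilings of the region without \<open>s\<close> are joined by flips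
  (\<open>flip_connectedI\<close>). For three rows \<open>s\<close> is the first column, so that what remains is again a
  rectangle with three rows, and induction on the number of columns finishes the proof. For two rows
  \<open>s\<close> is an L in the corner, then another L that completes the \<open>2 \<times> 3\<close> block, and one row
  has at most one tiling.

  The work is to bring \<open>s\<close> into an arbitrary tiling. Suppose that a corner cell is covered by a
  wrong tile \<open>w\<close>. One names a tile \<open>a\<close> disjoint from \<open>w\<close> such that \<open>w \<union> a\<close> splits in a
  second way as \<open>s \<union> a'\<close>, unless \<open>w\<close> isolates a cell and cannot occur. If \<open>a\<close> is in the tiling,
  a single flip brings in \<open>s\<close>; otherwise one first brings \<open>a\<close> into the tiling of the region
  without \<open>w\<close>, leaving \<open>w\<close> alone (\<open>leads_to_within\<close>). This replaces the question for one shape of the left boundary by the question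
  for another shape, and the choices can be made such that this stops. Counting the cells that are
  already covered in rows \<open>p\<close>, \<open>q\<close>, \<open>r\<close>, the shapes that occur are, up to a shift and a
  reflection,
    \<^item> the straight boundary \<open>(0, 0, 0)\<close> with the first column as target,
    \<^item> the notch \<open>(3, 0, 0)\<close>,
    \<^item> the stairs \<open>(2, 1, 0)\<close>,
    \<^item> the step \<open>(1, 0, 2)\<close>.

  Each of them refers only to shapes further down in this list. At the step a wrong tile forces
  its neighbour, and one flip of these two is enough. The two-row case ends at the same step, with
  the third row absent.

  The argument only re-splits the union of two tiles of a tiling that has already been reached.
  Hence it never has to be checked whether a tile fits into the grid, or whether the cells around it
  can still be tiled.
\<close>

section \<open>Trominoes, tilings and flips\<close>

definition next_to :: "nat \<Rightarrow> nat \<Rightarrow> bool" where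
  "next_to i j \<longleftrightarrow> j = Suc i \<or> i = Suc j"

definition adj :: "nat \<times> nat \<Rightarrow> nat \<times> nat \<Rightarrow> bool" where
  "adj x y \<longleftrightarrow> fst x = fst y \<and> next_to (snd x) (snd y) \<or> snd x = snd y \<and> next_to (fst x) (fst y)"

text \<open>A connected set of three cells always contains a path through all of them; \<open>y\<close> is its middle.\<close>

definition tromino :: "(nat \<times> nat) set \<Rightarrow> bool" where
  "tromino A \<longleftrightarrow> (\<exists>x y z. A = {x, y, z} \<and> x \<noteq> z \<and> adj x y \<and> adj y z)"

definition tilings :: "(nat \<times> nat) set \<Rightarrow> (nat \<times> nat) set set set" where
  "tilings R = {T. partition_on R T \<and> (\<forall>A\<in>T. tromino A)}"

definition flips :: "(nat \<times> nat) set \<Rightarrow> (nat \<times> nat) set set rel" where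
  "flips R = {(T, T'). T \<in> tilings R \<and> T' \<in> tilings R \<and> differ_on_two_parts T T'}"

definition flip_connected :: "(nat \<times> nat) set \<Rightarrow> bool" where
  "flip_connected R \<longleftrightarrow> (\<forall>T\<in>tilings R. \<forall>T'\<in>tilings R. (T, T') \<in> (flips R)\<^sup>*)"

definition leads_to :: "(nat \<times> nat) set \<Rightarrow> (nat \<times> nat) set set \<Rightarrow> (nat \<times> nat) set \<Rightarrow> bool" where
  "leads_to R T s \<longleftrightarrow> (\<exists>T'\<in>tilings R. (T, T') \<in> (flips R)\<^sup>* \<and> s \<in> T')"

lemma adj_iff [simp]:
  "adj (i, j) (i', j') \<longleftrightarrow> i = i' \<and> (j' = Suc j \<or> j = Suc j') \<or> j = j' \<and> next_to i i'"
  by (auto simp: adj_def next_to_def)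

lemma adj_sym: "adj x y \<Longrightarrow> adj y x"
  by (auto simp: adj_def next_to_def)

lemma adj_irrefl: "\<not> adj x x"
  by (auto simp: adj_def next_to_def)

lemma next_to_irrefl [simp]: "\<not> next_to i i"
  by (simp add: next_to_def)

lemma trominoI: "adj x y \<Longrightarrow> adj y z \<Longrightarrow> x \<noteq> z \<Longrightarrow> tromino {x, y, z}"
  unfolding tromino_def by blast

lemma tromino_nonempty: "tromino A \<Longrightarrow> A \<noteq> {}"
  by (auto simp: tromino_def)

text \<open>Seen from an arbitrary one of its cells, a tromino is either a path that starts there or a path
  whose middle is there.\<close>

lemma tromino_through:
  assumes "tromino A" and "c \<in> A"
  obtains y z where "A = {c, y, z}" "y \<noteq> z" "z \<noteq> c" "adj c y" "adj c z \<or> adj y z"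
proof -
  from assms(1) obtain u v w where A: "A = {u, v, w}" "u \<noteq> w" "adj u v" "adj v w"
    by (auto simp: tromino_def)
  then have "u \<noteq> v" "v \<noteq> w" by (auto simp: adj_irrefl)
  from assms(2) A(1) consider "c = u" | "c = v" | "c = w" by blast
  then show thesis
  proof cases
    case 1 with A \<open>v \<noteq> w\<close> show thesis by (intro that[of v w]) auto
  next
    case 2 with A \<open>v \<noteq> w\<close> show thesis
      by (intro that[of u w]) (auto simp: insert_commute intro: adj_sym)
  next
    case 3 with A \<open>u \<noteq> v\<close> show thesis
      by (intro that[of v u]) (auto simp: insert_commute intro: adj_sym)
  qed
qed

lemma differ_on_two_partsI:
  assumes "P \<noteq> Q" "A \<in> P" "B \<in> P" "C \<in> Q" "D \<in> Q" "A \<noteq> B" "C \<noteq> D"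
    "A \<union> B = C \<union> D" "P - {A, B} = Q - {C, D}"
  shows "differ_on_two_parts P Q"
  unfolding differ_on_two_parts_def
  by (intro conjI bexI[of _ A] bexI[of _ B] bexI[of _ C] bexI[of _ D]) (fact assms)+

lemma flips_sym: "(T, T') \<in> (flips R)\<^sup>* \<Longrightarrow> (T', T) \<in> (flips R)\<^sup>*"
proof -
  have "sym (flips R)" by (auto simp: flips_def intro!: symI differ_on_two_parts_sym)
  then show "(T, T') \<in> (flips R)\<^sup>* \<Longrightarrow> (T', T) \<in> (flips R)\<^sup>*"
    by (blast dest: sym_rtrancl symD)
qed

lemma tilings_insert:
  assumes "T \<in> tilings (R - s)" and "tromino s" and "s \<subseteq> R"
  shows "insert s T \<in> tilings R"
proof -
  have "disjnt s (\<Union>T)" using assms(1) by (auto simp: tilings_def partition_on_def disjnt_def)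
  then show ?thesis
    using assms by (auto simp: tilings_def partition_on_insert tromino_nonempty)
qed

lemma tilings_remove:
  assumes "T \<in> tilings R" and "s \<in> T"
  shows "T - {s} \<in> tilings (R - s)"
proof -
  have p: "partition_on R T" and t: "\<forall>A\<in>T. tromino A" using assms(1) by (auto simp: tilings_def)
  have "disjnt s (\<Union>(T - {s}))"
    using p assms(2) unfolding partition_on_def disjnt_def disjoint_def by blast
  then have "partition_on (R - s) (T - {s})"
    using p assms(2) partition_on_insert[of s "T - {s}" R] by (simp add: insert_absorb)
  with t show ?thesis by (auto simp: tilings_def)
qed

lemma tile_props:
  assumes "T \<in> tilings R" and "s \<in> T"
  shows "tromino s" "s \<subseteq> R"
  using assms by (auto simp: tilings_def dest: partition_onD1)

lemma covering_tile:
  assumes T: "T \<in> tilings R" and "c \<in> R"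
  obtains A where "A \<in> T" "tromino A" "A \<subseteq> R" "c \<in> A"
proof -
  have "c \<in> \<Union>T" using assms by (auto simp: tilings_def dest: partition_onD1)
  then obtain A where "A \<in> T" "c \<in> A" ..
  with tile_props[OF T, of A] show thesis by (intro that)
qed

lemma second_covering_tile:
  assumes "T \<in> tilings R" and "s \<in> T" and "c \<in> R - s"
  obtains A where "A \<in> T" "A \<noteq> s" "tromino A" "A \<subseteq> R - s" "c \<in> A"
proof -
  from covering_tile[OF tilings_remove[OF assms(1,2)] assms(3)]
  obtain A where "A \<in> T - {s}" "tromino A" "A \<subseteq> R - s" "c \<in> A" .
  then show thesis by (intro that[of A]) auto
qed

section \<open>Bringing a given tile into a tiling\<close>

lemma leads_to_refl: "T \<in> tilings R \<Longrightarrow> s \<in> T \<Longrightarrow> leads_to R T s"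
  by (auto simp: leads_to_def)

text \<open>The new tiling may coincide with the old one, for the two pairs of tiles may be the same; then
  no flip is made.\<close>

lemma leads_to_swap:
  assumes T: "T \<in> tilings R" and sa: "s \<in> T" "a \<in> T" "s \<noteq> a"
    and t: "tromino s'" "tromino a'" and u: "s \<union> a = s' \<union> a'" "s' \<inter> a' = {}"
  shows "leads_to R T s'"
proof -
  define U where "U = T - {s} - {a}"
  define T' where "T' = insert s' (insert a' U)"
  have U: "U \<in> tilings (R - s - a)"
    unfolding U_def using T sa by (intro tilings_remove) auto
  have eq: "R - s - a = R - s' - a'" using u(1) by blast
  have "a' \<subseteq> R - s'" "s' \<subseteq> R" using u tile_props[OF T sa(1)] tile_props[OF T sa(2)] by blast+
  then have T': "T' \<in> tilings R"
    unfolding T'_def using U t eq by (intro tilings_insert) auto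
  have "s' \<notin> U" "a' \<notin> U" "s' \<noteq> a'"
    using tile_props(2)[OF U, of s'] tile_props(2)[OF U, of a'] eq t u(2)
      tromino_nonempty by fast+
  then have rest: "T - {s, a} = T' - {s', a'}"
    by (auto simp: T'_def U_def)
  have "(T, T') \<in> (flips R)\<^sup>*"
  proof (cases "T = T'")
    case False
    have "differ_on_two_parts T T'"
      using False sa u(1) \<open>s' \<noteq> a'\<close> rest
      by (intro differ_on_two_partsI[of T T' s a s' a']) (simp_all add: T'_def)
    then show ?thesis using T T' by (auto simp: flips_def)
  qed simp
  with T' show ?thesis by (auto simp: leads_to_def T'_def)
qed

lemma differ_on_two_parts_insert:
  assumes "differ_on_two_parts V W" and new: "s \<notin> V" "s \<notin> W"
  shows "differ_on_two_parts (insert s V) (insert s W)"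
proof -
  from assms(1) obtain A B C D where w: "A \<in> V" "B \<in> V" "C \<in> W" "D \<in> W" "A \<noteq> B" "C \<noteq> D"
    "A \<union> B = C \<union> D" "V - {A, B} = W - {C, D}"
    unfolding differ_on_two_parts_def by (elim conjE bexE) (rule that)
  have "insert s V - {A, B} = insert s (V - {A, B})" "insert s W - {C, D} = insert s (W - {C, D})"
    using w(1-4) new by auto
  with w(8) have rest: "insert s V - {A, B} = insert s W - {C, D}" by simp
  have "insert s V \<noteq> insert s W"
    using assms by (simp add: insert_ident differ_on_two_parts_def)
  then show ?thesis
    using w(1-7) rest by (intro differ_on_two_partsI[of _ _ A B C D]) simp_all
qed

text \<open>A flip away from a fixed tile is a flip of the whole region.\<close>

lemma flips_insert:
  assumes "(T, T') \<in> (flips (R - s))\<^sup>*" and s: "tromino s" "s \<subseteq> R"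
  shows "(insert s T, insert s T') \<in> (flips R)\<^sup>*"
  using assms(1)
proof induction
  case (step V W)
  from step.hyps(2) have V: "V \<in> tilings (R - s)" and W: "W \<in> tilings (R - s)"
    and d: "differ_on_two_parts V W" by (auto simp: flips_def)
  have "s \<notin> V" "s \<notin> W"
    using tile_props(2)[OF V, of s] tile_props(2)[OF W, of s] tromino_nonempty[OF s(1)] by auto
  with d have "differ_on_two_parts (insert s V) (insert s W)"
    by (rule differ_on_two_parts_insert)
  moreover have "insert s V \<in> tilings R" "insert s W \<in> tilings R"
    using V W s by (simp_all add: tilings_insert)
  ultimately have "(insert s V, insert s W) \<in> flips R" by (simp add: flips_def)
  with step.IH show ?case by (rule rtrancl_into_rtrancl)
qed simp

lemma flip_connected_around_tile:
  assumes c: "flip_connected (R - s)" and T: "T \<in> tilings R" "s \<in> T" and T': "T' \<in> tilings R" "s \<in> T'"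
  shows "(T, T') \<in> (flips R)\<^sup>*"
proof -
  have "(T - {s}, T' - {s}) \<in> (flips (R - s))\<^sup>*"
    using c tilings_remove[OF T] tilings_remove[OF T'] by (auto simp: flip_connected_def)
  from flips_insert[OF this] T T' tile_props[OF T] show ?thesis
    by (simp add: insert_absorb)
qed

text \<open>The induction principle for flip connectivity: both tilings are led to tilings that contain the
  tile \<open>s\<close>, and these differ only outside \<open>s\<close>.\<close>

lemma flip_connectedI:
  assumes c: "flip_connected (R - s)" and l: "\<And>T. T \<in> tilings R \<Longrightarrow> leads_to R T s"
  shows "flip_connected R"
  unfolding flip_connected_def
proof (intro ballI)
  fix T T' assume "T \<in> tilings R" "T' \<in> tilings R"
  then obtain U U' where U: "U \<in> tilings R" "s \<in> U" "(T, U) \<in> (flips R)\<^sup>*"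
    and U': "U' \<in> tilings R" "s \<in> U'" "(T', U') \<in> (flips R)\<^sup>*"
    using l[of T] l[of T'] unfolding leads_to_def by blast
  note U(3)
  also have "(U, U') \<in> (flips R)\<^sup>*" by (rule flip_connected_around_tile[OF c U(1,2) U'(1,2)])
  also have "(U', T') \<in> (flips R)\<^sup>*" by (rule flips_sym[OF U'(3)])
  finally show "(T, T') \<in> (flips R)\<^sup>*" .
qed

text \<open>Composition of two adjustments. Outside the unwanted tile \<open>s\<close> the tile \<open>a\<close> is brought in, and
  then \<open>s\<close> and \<open>a\<close> are replaced together by \<open>s'\<close> and \<open>a'\<close>. This is what lets the analysis of one
  shape of the boundary be reduced to that of another one.\<close>

lemma leads_to_within:
  assumes T: "T \<in> tilings R" and s: "s \<in> T" and a: "leads_to (R - s) (T - {s}) a"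
    and t: "tromino s'" "tromino a'" and u: "s \<union> a = s' \<union> a'" "s' \<inter> a' = {}"
  shows "leads_to R T s'"
proof -
  from a obtain U where U: "U \<in> tilings (R - s)" "(T - {s}, U) \<in> (flips (R - s))\<^sup>*" "a \<in> U"
    unfolding leads_to_def by blast
  have s_props: "tromino s" "s \<subseteq> R" using tile_props[OF T s] .
  have "s \<noteq> a" using tile_props[OF U(1,3)] tromino_nonempty by blast
  moreover have V: "insert s U \<in> tilings R" using U(1) s_props by (rule tilings_insert)
  ultimately have "leads_to R (insert s U) s'"
    using U(3) t u by (intro leads_to_swap[of "insert s U" R s a s' a']) simp_all
  moreover have "(T, insert s U) \<in> (flips R)\<^sup>*"
    using flips_insert[OF U(2) s_props] s by (simp add: insert_absorb)
  ultimately show ?thesis unfolding leads_to_def by (blast intro: rtrancl_trans)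
qed

lemma tilings_empty: "tilings {} = {{}}"
  by (auto simp: tilings_def partition_on_def)

lemma flip_connected_empty: "flip_connected {}"
  by (simp add: flip_connected_def tilings_empty)

section \<open>Tiles at a cell with few neighbours\<close>

text \<open>The next three lemmas list the trominoes at a cell \<open>c\<close> of a region \<open>R\<close>. At the left boundary of
  a partially tiled grid, \<open>c\<close> has at most two neighbours in \<open>R\<close>, and the list is
  short.\<close>

lemma tromino_has_neighbour:
  assumes "tromino A" "c \<in> A" "A \<subseteq> R"
  obtains x where "x \<in> R" "adj c x"
proof -
  from tromino_through[OF assms(1,2)] obtain y z where "A = {c, y, z}" "adj c y" .
  with assms(3) show thesis by (intro that[of y]) simp_all
qed

lemma tromino_one_neighbour:
  assumes A: "tromino A" "c \<in> A" "A \<subseteq> R"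
    and c: "\<And>x. x \<in> R \<Longrightarrow> adj c x \<Longrightarrow> x = d"
    and d: "\<And>x. x \<in> R \<Longrightarrow> adj d x \<Longrightarrow> x \<noteq> c \<Longrightarrow> x \<in> Z"
  shows "\<exists>z\<in>Z. A = {c, d, z}"
proof -
  from tromino_through[OF A(1,2)] obtain y z where
    yz: "A = {c, y, z}" "y \<noteq> z" "z \<noteq> c" "adj c y" "adj c z \<or> adj y z" .
  then have "y \<in> R" "z \<in> R" using A(3) by auto
  then have "y = d" using c yz(4) by simp
  with c[of z] d[of z] yz \<open>z \<in> R\<close> show ?thesis by auto
qed

lemma tromino_two_neighbours:
  assumes A: "tromino A" "c \<in> A" "A \<subseteq> R"
    and c: "\<And>x. x \<in> R \<Longrightarrow> adj c x \<Longrightarrow> x = d \<or> x = e"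
    and d: "\<And>x. x \<in> R \<Longrightarrow> adj d x \<Longrightarrow> x \<noteq> c \<Longrightarrow> x \<in> Y"
    and e: "\<And>x. x \<in> R \<Longrightarrow> adj e x \<Longrightarrow> x \<noteq> c \<Longrightarrow> x \<in> Z"
  shows "A = {c, d, e} \<or> (\<exists>y\<in>Y. A = {c, d, y}) \<or> (\<exists>z\<in>Z. A = {c, e, z})"
proof -
  from tromino_through[OF A(1,2)] obtain y z where
    yz: "A = {c, y, z}" "y \<noteq> z" "z \<noteq> c" "adj c y" "adj c z \<or> adj y z" .
  then have R: "y \<in> R" "z \<in> R" using A(3) by auto
  show ?thesis
  proof (cases "adj c z")
    case True
    with c[of y] c[of z] yz R have "A = {c, d, e}" by auto
    then show ?thesis ..
  next
    case False
    with yz have "adj y z" by simp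
    with c[of y] d[of z] e[of z] yz R show ?thesis by blast
  qed
qed

section \<open>The boundary shapes of three rows\<close>

text \<open>What is left of row \<open>i\<close> in a grid with \<open>n\<close> columns when its first \<open>a\<close> cells are covered.\<close>

definition row :: "nat \<Rightarrow> nat \<Rightarrow> nat \<Rightarrow> (nat \<times> nat) set" where
  "row n i a = {i} \<times> {a..<n}"

lemma row_iff [simp]: "(i', j) \<in> row n i a \<longleftrightarrow> i' = i \<and> a \<le> j \<and> j < n"
  by (auto simp: row_def)

text \<open>Row \<open>q\<close> is the middle one; whether \<open>p\<close> or \<open>r\<close> is on top stays open, so that each lemma covers
  a boundary shape together with its mirror image.\<close>

definition path3 :: "nat \<Rightarrow> nat \<Rightarrow> nat \<Rightarrow> bool" where
  "path3 p q r \<longleftrightarrow> next_to p q \<and> next_to q r \<and> p \<noteq> r"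

lemma path3_facts:
  assumes "path3 p q r"
  shows "next_to p q" "next_to q p" "next_to q r" "next_to r q"
    "p \<noteq> q" "q \<noteq> p" "q \<noteq> r" "r \<noteq> q" "p \<noteq> r" "r \<noteq> p" "\<not> next_to p r" "\<not> next_to r p"
  using assms by (auto simp: path3_def next_to_def)

text \<open>The step. The cell \<open>(q, k)\<close> can be left only to the right. If its tile continues straight
  on, it walls off row \<open>p\<close>, whose next tile must then be horizontal as well; these two staggered
  bars can be split differently.

  The set \<open>S\<close> stands for the cells outside rows \<open>p\<close> and \<open>q\<close>: the rest of the third row if
  there is one. It only has to stay clear of the cells at which the argument
  looks.\<close>

lemma step_leads_to:
  assumes pq: "next_to p q"
    and S: "\<And>i j. (i, j) \<in> S \<Longrightarrow> k+2 \<le> j \<and> i \<noteq> p \<and> i \<noteq> q \<and> \<not> next_to p i"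
    and R: "R = row n p (k+1) \<union> row n q k \<union> S" and "k < n"
    and T: "T \<in> tilings R"
  shows "leads_to R T {(q,k), (q,k+1), (p,k+1)}" (is "leads_to R T ?Y")
proof -
  let ?X = "{(q,k), (q,k+1), (q,k+2)}"
  have [simp]: "next_to p q" "next_to q p" "p \<noteq> q" "q \<noteq> p"
    using pq by (auto simp: next_to_def)
  have R_iff: "(i, j) \<in> R \<longleftrightarrow> i = p \<and> k < j \<and> j < n \<or> i = q \<and> k \<le> j \<and> j < n \<or> (i, j) \<in> S" for i j
    using R by auto
  have [simp]: "(p, j) \<notin> S" "(q, j) \<notin> S" "(i, k) \<notin> S" "(i, Suc k) \<notin> S" for i j
    using S[of p j] S[of q j] S[of i k] S[of i "Suc k"] by auto
  have far: "(i, j) \<in> S \<Longrightarrow> \<not> next_to p i" for i j using S by blast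
  have "(q,k) \<in> R" using \<open>k < n\<close> by (simp add: R_iff)
  from covering_tile[OF T this]
  obtain A where A: "A \<in> T" "tromino A" "A \<subseteq> R" "(q,k) \<in> A" .
  have "\<exists>z\<in>{(p,k+1), (q,k+2)}. A = {(q,k), (q,k+1), z}"
    by (rule tromino_one_neighbour[OF A(2,4,3)]) (auto simp: R_iff)
  then consider "A = ?Y" | "A = ?X" by (elim bexE insertE emptyE) simp_all
  then show ?thesis
  proof cases
    case 1
    with A T show ?thesis by (simp add: leads_to_refl)
  next
    case 2
    have X: "?X \<in> T" and n: "k+2 < n" using 2 A(1,3) by (simp_all add: R_iff)
    have c: "(p,k+1) \<in> R - ?X" using n by (simp add: R_iff)
    from second_covering_tile[OF T X c]
    obtain B where B: "B \<in> T" "B \<noteq> ?X" "tromino B" "B \<subseteq> R - ?X" "(p,k+1) \<in> B" .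
    have "\<exists>z\<in>{(p,k+3)}. B = {(p,k+1), (p,k+2), z}"
      by (rule tromino_one_neighbour[OF B(3,5,4)]) (auto simp: R_iff dest: far)
    then have B': "B = {(p,k+1), (p,k+2), (p,k+3)}" by simp
    show ?thesis
    proof (rule leads_to_swap[OF T X B(1)])
      show "?X \<noteq> B" using B(2) by simp
      show "tromino ?Y" by (rule trominoI) simp_all
      show "tromino {(q,k+2), (p,k+2), (p,k+3)}" by (rule trominoI) simp_all
    qed (use B' in auto)
  qed
qed

text \<open>The stairs. A horizontal bar in row \<open>r\<close> turns them into a step, one column further to the
  right, and the target of that step completes the bar to a triangle of six cells, which can also be
  split into the target of the stairs and another L.\<close>

lemma stairs_lead_to:
  assumes path: "path3 p q r" and R: "R = row n p (k+2) \<union> row n q (k+1) \<union> row n r k"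
    and "k < n" and T: "T \<in> tilings R"
  shows "leads_to R T {(r,k), (r,k+1), (q,k+1)}" (is "leads_to R T ?Y")
proof -
  note [simp] = path3_facts[OF path]
  let ?X = "{(r,k), (r,k+1), (r,k+2)}"
  have "(r,k) \<in> R" using \<open>k < n\<close> by (simp add: R)
  from covering_tile[OF T this]
  obtain A where A: "A \<in> T" "tromino A" "A \<subseteq> R" "(r,k) \<in> A" .
  have "\<exists>z\<in>{(q,k+1), (r,k+2)}. A = {(r,k), (r,k+1), z}"
    by (rule tromino_one_neighbour[OF A(2,4,3)]) (auto simp: R)
  then consider "A = ?Y" | "A = ?X" by (elim bexE insertE emptyE) simp_all
  then show ?thesis
  proof cases
    case 1
    with A T show ?thesis by (simp add: leads_to_refl)
  next
    case 2
    have X: "?X \<in> T" and n: "k+2 < n" using 2 A(1,3) by (simp_all add: R)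
    have rest: "R - ?X = row n p (k+1+1) \<union> row n q (k+1) \<union> row n r (k+3)"
      by (auto simp: R)
    have "leads_to (R - ?X) (T - {?X}) {(q,k+1), (q,k+1+1), (p,k+1+1)}"
      by (rule step_leads_to[OF _ _ rest _ tilings_remove[OF T X]]) (use n in auto)
    then show ?thesis
      by (rule leads_to_within[OF T X _ _ trominoI[of "(r,k+2)" "(q,k+2)" "(p,k+2)"]])
        (auto intro: trominoI)
  qed
qed

text \<open>The notch. The wrong tiles are treated in three ways: next to a bar in row \<open>q\<close> there has to be
  a bar in row \<open>r\<close>; the L that encloses \<open>(r, k)\<close> is impossible; and the other L leaves a step, seen
  with the roles of \<open>p\<close> and \<open>r\<close> exchanged.\<close>

lemma notch_leads_to:
  assumes path: "path3 p q r" and R: "R = row n p (k+3) \<union> row n q k \<union> row n r k"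
    and "k < n" and T: "T \<in> tilings R"
  shows "leads_to R T {(r,k), (q,k), (q,k+1)}" (is "leads_to R T ?Y")
proof -
  note [simp] = path3_facts[OF path] numeral_3_eq_3
  let ?X = "{(q,k), (q,k+1), (q,k+2)}" and ?Z = "{(q,k), (r,k), (r,k+1)}"
    and ?W = "{(q,k), (q,k+1), (r,k+1)}"
  have tY: "tromino ?Y" by (rule trominoI) simp_all
  have tY': "tromino {(r,k+1), (r,k+2), (q,k+2)}" by (rule trominoI) simp_all
  have "(q,k) \<in> R" using \<open>k < n\<close> by (simp add: R)
  from covering_tile[OF T this]
  obtain A where A: "A \<in> T" "tromino A" "A \<subseteq> R" "(q,k) \<in> A" .
  have "A = {(q,k), (q,k+1), (r,k)} \<or> (\<exists>y\<in>{(q,k+2), (r,k+1)}. A = {(q,k), (q,k+1), y})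
      \<or> (\<exists>z\<in>{(r,k+1)}. A = {(q,k), (r,k), z})"
    by (rule tromino_two_neighbours[OF A(2,4,3)]) (auto simp: R)
  then consider "A = ?Y" | "A = ?X" | "A = ?W" | "A = ?Z"
    by (elim disjE bexE insertE emptyE) (simp_all add: insert_commute)
  then show ?thesis
  proof cases
    case 1
    with A T show ?thesis by (simp add: leads_to_refl)
  next
    case 2
    have X: "?X \<in> T" and n: "k+2 < n" using 2 A(1,3) by (simp_all add: R)
    have "(r,k) \<in> R - ?X" using n by (simp add: R)
    from second_covering_tile[OF T X this]
    obtain B where B: "B \<in> T" "B \<noteq> ?X" "tromino B" "B \<subseteq> R - ?X" "(r,k) \<in> B" .
    have "\<exists>z\<in>{(r,k+2)}. B = {(r,k), (r,k+1), z}"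
      by (rule tromino_one_neighbour[OF B(3,5,4)]) (auto simp: R)
    then have B': "B = {(r,k), (r,k+1), (r,k+2)}" by simp
    show ?thesis
      by (rule leads_to_swap[OF T X B(1) B(2)[symmetric] tY tY']) (use B' in auto)
  next
    case 3
    have W: "?W \<in> T" and n: "k+1 < n" using 3 A(1,3) by (simp_all add: R)
    have "(r,k) \<in> R - ?W" using n by (simp add: R)
    from second_covering_tile[OF T W this]
    obtain B where B: "B \<in> T" "B \<noteq> ?W" "tromino B" "B \<subseteq> R - ?W" "(r,k) \<in> B" .
    obtain x where "x \<in> R - ?W" "adj (r,k) x" using tromino_has_neighbour[OF B(3,5,4)] .
    then have False by (cases x) (auto simp: R)
    then show ?thesis ..
  next
    case 4
    have Z: "?Z \<in> T" and n: "k+1 < n" using 4 A(1,3) by (simp_all add: R)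
    have rest: "R - ?Z = row n r (k+1+1) \<union> row n q (k+1) \<union> row n p (k+3)"
      by (auto simp: R)
    have "leads_to (R - ?Z) (T - {?Z}) {(q,k+1), (q,k+1+1), (r,k+1+1)}"
      by (rule step_leads_to[OF _ _ rest _ tilings_remove[OF T Z]]) (use n in auto)
    then show ?thesis
      by (rule leads_to_within[OF T Z _ tY tY']) auto
  qed
qed

text \<open>The straight boundary. Of the four wrong tiles at the corner \<open>(p, k)\<close>, one leaves stairs, one
  leaves a notch, and each of the other two forces the tile next to it.\<close>

lemma three_rows_lead_to:
  assumes path: "path3 p q r" and R: "R = row n p k \<union> row n q k \<union> row n r k"
    and "k < n" and T: "T \<in> tilings R"
  shows "leads_to R T {(p,k), (q,k), (r,k)}" (is "leads_to R T ?V")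
proof -
  note [simp] = path3_facts[OF path] numeral_3_eq_3
  let ?L = "{(p,k), (p,k+1), (q,k)}" and ?I = "{(p,k), (p,k+1), (p,k+2)}"
    and ?M = "{(p,k), (p,k+1), (q,k+1)}" and ?N = "{(p,k), (q,k), (q,k+1)}"
  have tV: "tromino ?V" by (rule trominoI) simp_all
  have tW: "tromino {(p,k+1), (q,k+1), (r,k+1)}" by (rule trominoI) simp_all
  have "(p,k) \<in> R" using \<open>k < n\<close> by (simp add: R)
  from covering_tile[OF T this]
  obtain A where A: "A \<in> T" "tromino A" "A \<subseteq> R" "(p,k) \<in> A" .
  have "A = {(p,k), (p,k+1), (q,k)} \<or> (\<exists>y\<in>{(p,k+2), (q,k+1)}. A = {(p,k), (p,k+1), y})
      \<or> (\<exists>z\<in>{(q,k+1), (r,k)}. A = {(p,k), (q,k), z})"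
    by (rule tromino_two_neighbours[OF A(2,4,3)]) (auto simp: R)
  then consider "A = ?V" | "A = ?L" | "A = ?I" | "A = ?M" | "A = ?N"
    by (elim disjE bexE insertE emptyE) simp_all
  then show ?thesis
  proof cases
    case 1
    with A T show ?thesis by (simp add: leads_to_refl)
  next
    case 2
    have L: "?L \<in> T" using 2 A(1) by simp
    have rest: "R - ?L = row n p (k+2) \<union> row n q (k+1) \<union> row n r k" by (auto simp: R)
    have "leads_to (R - ?L) (T - {?L}) {(r,k), (r,k+1), (q,k+1)}"
      by (rule stairs_lead_to[OF path rest \<open>k < n\<close> tilings_remove[OF T L]])
    then show ?thesis by (rule leads_to_within[OF T L _ tV tW]) auto
  next
    case 3
    have I: "?I \<in> T" using 3 A(1) by simp
    have rest: "R - ?I = row n p (k+3) \<union> row n q k \<union> row n r k" by (auto simp: R)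
    have "leads_to (R - ?I) (T - {?I}) {(r,k), (q,k), (q,k+1)}"
      by (rule notch_leads_to[OF path rest \<open>k < n\<close> tilings_remove[OF T I]])
    then show ?thesis
      by (rule leads_to_within[OF T I _ tV trominoI[of "(p,k+2)" "(p,k+1)" "(q,k+1)"]]) auto
  next
    case 4
    have M: "?M \<in> T" using 4 A(1) by simp
    have "(q,k) \<in> R - ?M" using \<open>k < n\<close> by (simp add: R)
    from second_covering_tile[OF T M this]
    obtain B where B: "B \<in> T" "B \<noteq> ?M" "tromino B" "B \<subseteq> R - ?M" "(q,k) \<in> B" .
    have "\<exists>z\<in>{(r,k+1)}. B = {(q,k), (r,k), z}"
      by (rule tromino_one_neighbour[OF B(3,5,4)]) (auto simp: R)
    then have B': "B = {(q,k), (r,k), (r,k+1)}" by simp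
    show ?thesis
      by (rule leads_to_swap[OF T M B(1) B(2)[symmetric] tV tW]) (use B' in auto)
  next
    case 5
    have N: "?N \<in> T" using 5 A(1) by simp
    have "(r,k) \<in> R - ?N" using \<open>k < n\<close> by (simp add: R)
    from second_covering_tile[OF T N this]
    obtain B where B: "B \<in> T" "B \<noteq> ?N" "tromino B" "B \<subseteq> R - ?N" "(r,k) \<in> B" .
    have "\<exists>z\<in>{(r,k+2)}. B = {(r,k), (r,k+1), z}"
      by (rule tromino_one_neighbour[OF B(3,5,4)]) (auto simp: R)
    then have B': "B = {(r,k), (r,k+1), (r,k+2)}" by simp
    show ?thesis
      by (rule leads_to_swap[OF T N B(1) B(2)[symmetric] tV trominoI[of "(q,k+1)" "(r,k+1)" "(r,k+2)"]])
        (use B' in auto)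
  qed
qed

section \<open>Flip connectivity of grids with at most three rows\<close>

lemma flip_connected_three_rows:
  assumes path: "path3 p q r"
  shows "flip_connected (row n p k \<union> row n q k \<union> row n r k)"
proof (induction "n - k" arbitrary: k)
  case 0
  then have "row n p k \<union> row n q k \<union> row n r k = {}" by (auto simp: row_def)
  then show ?case by (simp only: flip_connected_empty)
next
  case (Suc d)
  let ?R = "row n p k \<union> row n q k \<union> row n r k" and ?V = "{(p,k), (q,k), (r,k)}"
  have "k < n" using Suc(2) by simp
  have "?R - ?V = row n p (k+1) \<union> row n q (k+1) \<union> row n r (k+1)" by (auto simp: path3_facts[OF path])
  moreover have "flip_connected (row n p (k+1) \<union> row n q (k+1) \<union> row n r (k+1))"
    using Suc(2) by (intro Suc(1)) simp
  ultimately have "flip_connected (?R - ?V)" by simp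
  then show ?case
    by (rule flip_connectedI) (rule three_rows_lead_to[OF path refl \<open>k < n\<close>])
qed

text \<open>Of the three wrong tiles at \<open>(p, k)\<close>, the bar forces a second bar in row \<open>q\<close>; the L that
  encloses \<open>(q, k)\<close> is impossible; and the L with two cells in row \<open>q\<close> leaves a step with the two rows
  exchanged, whose target completes that L to a \<open>2 \<times> 3\<close> block.\<close>

lemma two_rows_lead_to:
  assumes pq: "next_to p q" and R: "R = row n p k \<union> row n q k"
    and "k < n" and T: "T \<in> tilings R"
  shows "leads_to R T {(q,k), (p,k), (p,k+1)}" (is "leads_to R T ?L")
proof -
  have [simp]: "next_to p q" "next_to q p" "p \<noteq> q" "q \<noteq> p"
    using pq by (auto simp: next_to_def)
  note [simp] = numeral_3_eq_3
  let ?I = "{(p,k), (p,k+1), (p,k+2)}"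
    and ?M = "{(p,k), (p,k+1), (q,k+1)}" and ?N = "{(p,k), (q,k), (q,k+1)}"
  have tL: "tromino ?L" by (rule trominoI) simp_all
  have tL': "tromino {(q,k+1), (q,k+2), (p,k+2)}" by (rule trominoI) simp_all
  have "(p,k) \<in> R" using \<open>k < n\<close> by (simp add: R)
  from covering_tile[OF T this]
  obtain A where A: "A \<in> T" "tromino A" "A \<subseteq> R" "(p,k) \<in> A" .
  have "A = {(p,k), (p,k+1), (q,k)} \<or> (\<exists>y\<in>{(p,k+2), (q,k+1)}. A = {(p,k), (p,k+1), y})
      \<or> (\<exists>z\<in>{(q,k+1)}. A = {(p,k), (q,k), z})"
    by (rule tromino_two_neighbours[OF A(2,4,3)]) (auto simp: R)
  then consider "A = ?L" | "A = ?I" | "A = ?M" | "A = ?N"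
    by (elim disjE bexE insertE emptyE) (simp_all add: insert_commute)
  then show ?thesis
  proof cases
    case 1
    with A T show ?thesis by (simp add: leads_to_refl)
  next
    case 2
    have I: "?I \<in> T" using 2 A(1) by simp
    have "(q,k) \<in> R - ?I" using \<open>k < n\<close> by (simp add: R)
    from second_covering_tile[OF T I this]
    obtain B where B: "B \<in> T" "B \<noteq> ?I" "tromino B" "B \<subseteq> R - ?I" "(q,k) \<in> B" .
    have "\<exists>z\<in>{(q,k+2)}. B = {(q,k), (q,k+1), z}"
      by (rule tromino_one_neighbour[OF B(3,5,4)]) (auto simp: R)
    then have B': "B = {(q,k), (q,k+1), (q,k+2)}" by simp
    show ?thesis
      by (rule leads_to_swap[OF T I B(1) B(2)[symmetric] tL tL']) (use B' in auto)
  next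
    case 3
    have M: "?M \<in> T" using 3 A(1) by simp
    have "(q,k) \<in> R - ?M" using \<open>k < n\<close> by (simp add: R)
    from second_covering_tile[OF T M this]
    obtain B where B: "B \<in> T" "B \<noteq> ?M" "tromino B" "B \<subseteq> R - ?M" "(q,k) \<in> B" .
    obtain x where "x \<in> R - ?M" "adj (q,k) x" using tromino_has_neighbour[OF B(3,5,4)] .
    then have False by (cases x) (auto simp: R)
    then show ?thesis ..
  next
    case 4
    have N: "?N \<in> T" and n: "k+1 < n" using 4 A(1,3) by (simp_all add: R)
    have rest: "R - ?N = row n q (k+1+1) \<union> row n p (k+1) \<union> {}" by (auto simp: R)
    have "leads_to (R - ?N) (T - {?N}) {(p,k+1), (p,k+1+1), (q,k+1+1)}"
      by (rule step_leads_to[OF _ _ rest n tilings_remove[OF T N]]) simp_all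
    then show ?thesis
      by (rule leads_to_within[OF T N _ tL tL']) auto
  qed
qed

lemma flip_connected_two_rows:
  assumes pq: "next_to p q"
  shows "flip_connected (row n p k \<union> row n q k)"
proof (induction "n - k" arbitrary: k rule: less_induct)
  case less
  have [simp]: "next_to p q" "next_to q p" "p \<noteq> q" "q \<noteq> p"
    using pq by (auto simp: next_to_def)
  let ?R = "row n p k \<union> row n q k"
  show ?case
  proof (cases "k < n")
    case False
    then have "?R = {}" by (auto simp: row_def)
    then show ?thesis by (simp only: flip_connected_empty)
  next
    case True
    \<comment> \<open>Two L-shaped tiles that together fill columns \<open>k\<close> to \<open>k+2\<close>.\<close>
    let ?L = "{(q,k), (p,k), (p,k+1)}" and ?Y = "{(q,k+1), (q,k+1+1), (p,k+1+1)}"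
    have rest: "?R - ?L = row n p (k+1+1) \<union> row n q (k+1) \<union> {}" by auto
    have "flip_connected (?R - ?L)"
    proof (cases "k + 1 < n")
      case False
      then have "?R - ?L = {}" unfolding rest by (auto simp: row_def)
      then show ?thesis by (simp only: flip_connected_empty)
    next
      case True
      have "?R - ?L - ?Y = row n p (k+3) \<union> row n q (k+3)" by auto
      moreover have "flip_connected (row n p (k+3) \<union> row n q (k+3))"
        using True by (intro less) simp
      ultimately have "flip_connected (?R - ?L - ?Y)" by simp
      then show ?thesis
        by (rule flip_connectedI) (rule step_leads_to[OF pq _ rest True], simp_all)
    qed
    then show ?thesis
      by (rule flip_connectedI) (rule two_rows_lead_to[OF pq refl True])
  qed
qed

lemma flip_connected_one_row: "flip_connected (row n p k)"
proof (induction "n - k" arbitrary: k rule: less_induct)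
  case less
  show ?case
  proof (cases "k < n")
    case False
    then have "row n p k = {}" by (auto simp: row_def)
    then show ?thesis by (simp only: flip_connected_empty)
  next
    case True
    let ?I = "{(p,k), (p,k+1), (p,k+2)}"
    have "row n p k - ?I = row n p (k+3)" by auto
    moreover have "flip_connected (row n p (k+3))" using True by (intro less) simp
    ultimately have "flip_connected (row n p k - ?I)" by simp
    then show ?thesis
    proof (rule flip_connectedI)
      fix T assume T: "T \<in> tilings (row n p k)"
      have "(p,k) \<in> row n p k" using True by simp
      from covering_tile[OF T this]
      obtain A where A: "A \<in> T" "tromino A" "A \<subseteq> row n p k" "(p,k) \<in> A" .
      have "\<exists>z\<in>{(p,k+2)}. A = {(p,k), (p,k+1), z}"
        by (rule tromino_one_neighbour[OF A(2,4,3)]) auto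
      then have "?I \<in> T" using A(1) by simp
      then show "leads_to (row n p k) T ?I" by (rule leads_to_refl[OF T])
    qed
  qed
qed

section \<open>The metagraph of the grid\<close>

text \<open>In a connected graph with three vertices every vertex has a neighbour. If \<open>a\<close> and \<open>w\<close> are
  neighbours, the third vertex is adjacent to one of them, and this one is the middle of a path.\<close>

lemma connected_triple_iff:
  assumes "pair_graph G" and AG: "A \<subseteq> pverts G"
  shows "card A = 3 \<and> Digraph_Component.connected (with_proj G \<restriction> A) \<longleftrightarrow>
    (\<exists>x y z. A = {x, y, z} \<and> x \<noteq> z \<and> (x, y) \<in> parcs G \<and> (y, z) \<in> parcs G)"
    (is "?L \<longleftrightarrow> ?R")
proof -
  interpret G: pair_graph G by fact
  define H where "H = mk_symmetric (with_proj G \<restriction> A)"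
  have sym: "(v, u) \<in> parcs G" if "(u, v) \<in> parcs G" for u v
    using G.graph_symmetric that by simp
  have irrefl: "(u, u) \<notin> parcs G" for u
    using G.no_loops by fastforce
  have pverts_H: "pverts H = A" by (simp add: H_def)
  have parcs_H: "parcs H = parcs G \<inter> A \<times> A"
    by (auto simp: H_def parcs_mk_symmetric intro: sym)
  interpret H: pair_wf_digraph H
    by unfold_locales (auto simp: pverts_H parcs_H)
  have connected_iff: "Digraph_Component.connected (with_proj G \<restriction> A)
      \<longleftrightarrow> A \<noteq> {} \<and> (\<forall>u\<in>A. \<forall>v\<in>A. u \<rightarrow>\<^sup>*\<^bsub>with_proj H\<^esub> v)"
    unfolding Digraph_Component.connected_def strongly_connected_def H_def[symmetric]
    by (simp add: pverts_H)
  show ?thesis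
  proof
    assume L: ?L
    then obtain a b c where abc: "A = {a, b, c}" "a \<noteq> b" "b \<noteq> c" "a \<noteq> c"
      by (auto simp: card_3_iff)
    have nb: "\<exists>w\<in>A. w \<noteq> u \<and> (u, w) \<in> parcs G" if "u \<in> A" "v \<in> A" "u \<noteq> v" for u v
    proof -
      have "u \<rightarrow>\<^sup>*\<^bsub>with_proj H\<^esub> v" using L that connected_iff by blast
      then obtain w where "(u, w) \<in> parcs H"
        using \<open>u \<noteq> v\<close> by (cases rule: H.converse_reachable_cases) auto
      moreover from this have "w \<noteq> u" using irrefl by (auto simp: parcs_H)
      ultimately show ?thesis by (auto simp: parcs_H)
    qed
    have "a \<in> A" "b \<in> A" using abc by simp_all
    from nb[OF this \<open>a \<noteq> b\<close>] obtain w where w: "w \<in> A" "w \<noteq> a" "(a, w) \<in> parcs G"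
      by blast
    obtain t where t: "A = {a, w, t}" "t \<noteq> a" "t \<noteq> w"
    proof (cases "w = b")
      case True
      with abc show thesis by (intro that[of c]) simp_all
    next
      case False
      with w(1,2) abc have "w = c" by simp
      with abc show thesis by (intro that[of b]) (simp_all add: insert_commute)
    qed
    have "t \<in> A" using t(1) by simp
    from nb[OF this \<open>a \<in> A\<close> t(2)] obtain v where v: "v \<in> A" "v \<noteq> t" "(t, v) \<in> parcs G"
      by blast
    with t(1) consider "v = w" | "v = a" by auto
    then show ?R
    proof cases
      case 1
      with t w(3) v(3) show ?thesis
        by (intro exI[of _ a] exI[of _ w] exI[of _ t]) (simp add: sym)
    next
      case 2
      with t w(3) v(3) show ?thesis
        by (intro exI[of _ w] exI[of _ a] exI[of _ t]) (simp add: sym insert_commute)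
    qed
  next
    assume ?R
    then obtain x y z where xyz: "A = {x, y, z}" "x \<noteq> z" "(x, y) \<in> parcs G" "(y, z) \<in> parcs G"
      by (elim exE conjE)
    then have "x \<noteq> y" "y \<noteq> z" using irrefl by auto
    with xyz have card: "card A = 3" by simp
    have arcs: "(x, y) \<in> parcs H" "(y, x) \<in> parcs H" "(y, z) \<in> parcs H" "(z, y) \<in> parcs H"
      using xyz sym by (auto simp: parcs_H)
    have to_y: "u \<rightarrow>\<^sup>*\<^bsub>with_proj H\<^esub> y" and from_y: "y \<rightarrow>\<^sup>*\<^bsub>with_proj H\<^esub> u" if "u \<in> A" for u
      using that arcs by (auto simp: xyz(1) pverts_H)
    have "u \<rightarrow>\<^sup>*\<^bsub>with_proj H\<^esub> v" if "u \<in> A" "v \<in> A" for u v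
      using to_y[OF that(1)] from_y[OF that(2)] by (rule H.reachable_trans)
    moreover have "A \<noteq> {}" using xyz(1) by simp
    ultimately show ?L using card connected_iff by simp
  qed
qed

lemma connected_partitions_grid:
  "connected_partitions (grid_graph m n) 3 = tilings ({..<m} \<times> {..<n})"
proof -
  have verts: "pverts (grid_graph m n) = {..<m} \<times> {..<n}" by (simp add: grid_graph_def)
  have arcs: "(x, y) \<in> parcs (grid_graph m n) \<longleftrightarrow> adj x y"
    if "x \<in> {..<m} \<times> {..<n}" "y \<in> {..<m} \<times> {..<n}" for x y
    using that by (cases x; cases y) (auto simp: grid_graph_def next_to_def)
  have part: "card A = 3 \<and> Digraph_Component.connected (with_proj (grid_graph m n) \<restriction> A) \<longleftrightarrow> tromino A"
    if A: "A \<subseteq> {..<m} \<times> {..<n}" for A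
  proof -
    have "(\<exists>x y z. A = {x, y, z} \<and> x \<noteq> z
        \<and> (x, y) \<in> parcs (grid_graph m n) \<and> (y, z) \<in> parcs (grid_graph m n)) \<longleftrightarrow> tromino A"
      unfolding tromino_def using A arcs by (intro ex_cong1 conj_cong refl) simp_all
    then show ?thesis
      using connected_triple_iff[OF pair_graph_grid_graph, of A m n] A verts by simp
  qed
  have sub: "A \<subseteq> {..<m} \<times> {..<n}" if "partition_on ({..<m} \<times> {..<n}) P" "A \<in> P" for A P
    using that by (auto dest: partition_onD1)
  show ?thesis
    unfolding connected_partitions_def tilings_def verts
    by (intro Collect_cong conj_cong refl ball_cong part sub)
qed

lemma connected_or_empty_metagraph_grid:
  assumes "flip_connected ({..<m} \<times> {..<n})"
  shows "connected_or_empty (metagraph (grid_graph m n) 3)"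
proof -
  let ?M = "metagraph (grid_graph m n) 3"
  interpret M: pair_graph ?M
    by (rule pair_graph_metagraph) (simp add: grid_graph_def)
  have verts: "pverts ?M = tilings ({..<m} \<times> {..<n})"
    by (simp add: metagraph_def connected_partitions_grid)
  have arcs: "parcs ?M = flips ({..<m} \<times> {..<n})"
    by (simp add: metagraph_def connected_partitions_grid flips_def)
  have reach: "P \<rightarrow>\<^sup>*\<^bsub>with_proj ?M\<^esub> Q" if "(P, Q) \<in> (flips ({..<m} \<times> {..<n}))\<^sup>*" "P \<in> pverts ?M" for P Q
    using that(1)
  proof induction
    case base
    show ?case using that(2) by (rule M.reachable_refl)
  next
    case (step Q Q')
    then show ?case using M.reachable_adj_trans[of P Q Q'] by (simp add: arcs)
  qed
  have "strongly_connected (with_proj (mk_symmetric (with_proj ?M)))" if "pverts ?M \<noteq> {}"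
  proof (rule strongly_connectedI)
    show "verts (with_proj (mk_symmetric (with_proj ?M))) \<noteq> {}" using that by simp
    fix P Q assume "P \<in> verts (with_proj (mk_symmetric (with_proj ?M)))"
      "Q \<in> verts (with_proj (mk_symmetric (with_proj ?M)))"
    then have "P \<in> pverts ?M" "Q \<in> pverts ?M" by simp_all
    with assms have "P \<rightarrow>\<^sup>*\<^bsub>with_proj ?M\<^esub> Q"
      unfolding flip_connected_def by (intro reach) (simp_all add: verts)
    then show "P \<rightarrow>\<^sup>*\<^bsub>with_proj (mk_symmetric (with_proj ?M))\<^esub> Q"
      by (rule M.reachable_mk_symmetricI)
  qed
  then show ?thesis
    unfolding connected_or_empty_def Digraph_Component.connected_def by blast
qed

theorem theorem3p1:
  fixes m n :: nat
  assumes "0 < m" and "0 < n" and "m \<le> 3"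
  shows "connected_or_empty (metagraph (grid_graph m n) 3)"
proof (rule connected_or_empty_metagraph_grid)
  from assms consider "m = 1" | "m = 2" | "m = 3" by linarith
  then show "flip_connected ({..<m} \<times> {..<n})"
  proof cases
    case 1
    then have "{..<m} \<times> {..<n} = row n 0 0" by (auto simp: row_def)
    then show ?thesis by (simp only: flip_connected_one_row)
  next
    case 2
    then have eq: "{..<m} \<times> {..<n} = row n 0 0 \<union> row n 1 0" by (auto simp: row_def)
    show ?thesis unfolding eq by (rule flip_connected_two_rows) (simp add: next_to_def)
  next
    case 3
    then have eq: "{..<m} \<times> {..<n} = row n 0 0 \<union> row n 1 0 \<union> row n 2 0" by (auto simp: row_def)
    show ?thesis unfolding eq by (rule flip_connected_three_rows) (simp add: path3_def next_to_def)
  qed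
qed

end
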